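(* Let $T\in\mathcal{K}(V)$ be bisectorial of angle $\omega\in(0,\frac{\pi}{2})$ and let $A\in\mathcal{K}(V)$ be such that $$AQ_s[T]^{-1}\supseteq Q_s[T]^{-1}A\qquad\text{and}\qquad ATQ_s[T]^{-1}\supseteq TQ_s[T]^{-1}A$$ for every $s\in\mathbb{R}^{n+1}\setminus\overline{D_\omega}$. Then for every $\theta\in(\omega,\frac{\pi}{2})$ and every $g\in\mathcal{N}^{\mathrm{bnd}}(D_\theta)$ one has $$Ag(T)\supseteq g(T)A,$$ where $g(T)$ is given by the extended $\omega$-functional calculus.
   Context: Clifford setting. Fix an integer $n\geq 1$. $\mathbb{R}_n$ is the real Clifford algebra generated by $e_1,\dots,e_n$ with $e_i^2=-1$, $e_ie_j=-e_je_i$ ($i\neq j$), with basis $e_A=e_{i_1}\cdots e_{i_r}$ for $A=(i_1<\dots<i_r)$, $e_\emptyset=1$, and $|s|^2=\sum_As_A^2$ for $s=\sum_As_Ae_A$. Paravectors: $\mathbb{R}^{n+1}=\{s_0+s_1e_1+\dots+s_ne_n\}\subseteq\mathbb{R}_n$ with $\overline{s}=s_0-s_1e_1-\dots-s_ne_n$. $\mathbb{S}=\{s\in\mathbb{R}^{n+1}: s_0=0,|s|=1\}$ and $\mathbb{C}_J=\{x+Jy: x,y\in\mathbb{R}\}$ for $J\in\mathbb{S}$. $U\subseteq\mathbb{R}^{n+1}$ is axially symmetric if $x+Jy\in U$ ($x,y\in\mathbb{R}$, $J\in\mathbb{S}$) implies $x+Iy\in U$ for all $I\in\mathbb{S}$.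 Slice hyperholomorphic functions. For $U$ open and axially symmetric, $f:U\to\mathbb{R}_n$ is left slice hyperholomorphic ($f\in\mathcal{SH}_L(U)$) if there are continuously differentiable $f_0,f_1:\{(x,y)\in\mathbb{R}^2: x+\mathbb{S}y\subseteq U\}\to\mathbb{R}_n$ with $f(x+Jy)=f_0(x,y)+Jf_1(x,y)$ for all $J\in\mathbb{S}$, $f_0(x,-y)=f_0(x,y)$, $f_1(x,-y)=-f_1(x,y)$, $\partial_xf_0=\partial_yf_1$, $\partial_yf_0=-\partial_xf_1$. If $f_0,f_1$ are real valued, $f$ is called intrinsic ($f\in\mathcal{N}(U)$). Operators. $V_\mathbb{R}$ is a real Banach space, $V=\{\sum_Av_A\otimes e_A: v_A\in V_\mathbb{R}\}$ the corresponding Clifford module with norm $\|v\|^2=\sum_A\|v_A\|^2$ and the natural left and right multiplications by $\mathbb{R}_n$. $\mathcal{B}(V)$: bounded everywhere defined right-linear operators; $\mathcal{K}(V)$: closed right-linear operators $T:\operatorname{dom}(T)\to V$ with right-linear domain $\operatorname{dom}(T)\subseteq V$. A Clifford number $a$ is identified with the operator $v\mapsto av$, so $(aT)v=a(Tv)$, $(Ta)v=T(av)$. For operators, $A\subseteq B$ means $\operatorname{dom}(A)\subseteq\operatorname{dom}(B)$ and $Av=Bv$ for $v\in\operatorname{dom}(A)$; products have their natural domains. For $s\in\mathbb{R}^{n+1}$, $Q_s[T]=T^2-2s_0T+|s|^2$ on $\operatorname{dom}(T^2)$; $\rho_S(T)=\{s\in\mathbb{R}^{n+1}: Q_s[T]^{-1}\in\mathcal{B}(V)\}$,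 $\sigma_S(T)=\mathbb{R}^{n+1}\setminus\rho_S(T)$, and $S_L^{-1}(s,T)=Q_s[T]^{-1}\overline{s}-TQ_s[T]^{-1}$ for $s\in\rho_S(T)$. Bisectorial operators. For $\omega\in(0,\frac{\pi}{2})$, $I_\omega=(-\omega,\omega)\cup(\pi-\omega,\pi+\omega)$ and $D_\omega=\{re^{J\phi}: r>0,\,J\in\mathbb{S},\,\phi\in I_\omega\}\subseteq\mathbb{R}^{n+1}$. $T\in\mathcal{K}(V)$ is bisectorial of angle $\omega$ if $\sigma_S(T)\subseteq\overline{D_\omega}$ and for every $\varphi\in(\omega,\frac{\pi}{2})$ there is $C_\varphi\geq 0$ with $\|S_L^{-1}(s,T)\|\leq\frac{C_\varphi}{|s|}$ for all $s\in\mathbb{R}^{n+1}\setminus(D_\varphi\cup\{0\})$. $\omega$-functional calculus. $\mathcal{SH}_L^0(D_\theta)$ is the set of bounded $f\in\mathcal{SH}_L(D_\theta)$ with $\int_0^\infty|f(te^{J\phi})|\frac{dt}{t}<\infty$ for all $J\in\mathbb{S}$, $\phi\in I_\theta$; $\mathcal{N}^0(D_\theta)$ is the set of intrinsic such functions. For $T$ bisectorial of angle $\omega$, $\theta\in(\omega,\frac{\pi}{2})$ and $f\in\mathcal{SH}_L^0(D_\theta)$, $$f(T)=\frac{1}{2\pi}\int_{\partial D_\varphi\cap\mathbb{C}_J}S_L^{-1}(s,T)ds_Jf(s):=\frac{1}{2\pi}\sum_\pm\int_\mathbb{R}S_L^{-1}(\gamma_\pm(t),T)\frac{\gamma_\pm'(t)}{J}f(\gamma_\pm(t))dt\in\mathcal{B}(V),$$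 with $\gamma_\pm(t)=\pm|t|e^{-\operatorname{sgn}(t)J\varphi}$; it does not depend on the choice of $\varphi\in(\omega,\theta)$ and $J\in\mathbb{S}$. Extended $\omega$-functional calculus. $\mathcal{N}^{\mathrm{bnd}}(D_\theta)$ is the set of functions $g(s)=g_\infty+\frac{1}{1+s^2}(g_0-g_\infty)+\widetilde{g}(s)$ on $D_\theta$ with $g_0,g_\infty\in\mathbb{R}$, $\widetilde{g}\in\mathcal{N}^0(D_\theta)$ (unique components). For such $g$, $g(T):=g_\infty+(1+T^2)^{-1}(g_0-g_\infty)+\widetilde{g}(T)\in\mathcal{B}(V)$, with $\widetilde{g}(T)$ from the $\omega$-functional calculus; here $1+T^2$ is boundedly invertible since $\mathbb{S}\subseteq\rho_S(T)$. *)

theory Defs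
  imports "HOL-Analysis.Analysis"
begin

text \<open>
  The generators of the Clifford algebra \<open>\<real>\<^sub>n\<close> are indexed by a finite linearly ordered type
  \<open>'n\<close> with \<open>n = CARD('n) \<ge> 1\<close>.  The coordinate of an element at \<open>A :: 'n set\<close> is the
  coefficient of \<open>e\<^sub>A\<close>.  In the same way, \<open>\<Sum>\<^sub>A v\<^sub>A \<otimes> e\<^sub>A\<close> is the family \<open>(v\<^sub>A)\<close>.  The library norm
  on \<open>vec\<close> is the \<open>\<ell>\<^sup>2\<close> norm, so it is the prescribed norm on \<open>\<real>\<^sub>n\<close> and on \<open>V\<close>; the library
  multiplication on \<open>vec\<close> is componentwise and is not used.
\<close>

type_synonym 'n clifford = "(real, 'n set) vec"
type_synonym ('v, 'n) cl_module = "('v, 'n set) vec"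

text \<open>
  \<open>e\<^sub>A e\<^sub>B = \<plusminus> e\<^bsub>A \<triangle> B\<^esub>\<close>: each pair \<open>(i, j) \<in> A \<times> B\<close> with \<open>j < i\<close> costs one transposition of
  generators, and each pair with \<open>i = j\<close> contributes \<open>e\<^sub>i\<^sup>2 = -1\<close>.
\<close>

definition cl_sign :: "'n::{finite,linorder} set \<Rightarrow> 'n set \<Rightarrow> real" where
  "cl_sign A B = (-1) ^ card {(i, j). i \<in> A \<and> j \<in> B \<and> j \<le> i}"

text \<open>Left multiplication on \<open>V\<close>; for \<open>'v = real\<close> this is the product of \<open>\<real>\<^sub>n\<close>.\<close>

definition cl_lmul ::
  "'n::{finite,linorder} clifford \<Rightarrow> ('v::real_normed_vector, 'n) cl_module \<Rightarrow> ('v, 'n) cl_module"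
  (infixr "\<odot>" 75) where
  "a \<odot> v = (\<Sum>A\<in>UNIV. \<Sum>B\<in>UNIV. axis (sym_diff A B) ((cl_sign A B * a $ A) *\<^sub>R (v $ B)))"

definition cl_rmul ::
  "('v::real_normed_vector, 'n::{finite,linorder}) cl_module \<Rightarrow> 'n clifford \<Rightarrow> ('v, 'n) cl_module"
  (infixl "\<odot>\<^sub>r" 75) where
  "v \<odot>\<^sub>r a = (\<Sum>A\<in>UNIV. \<Sum>B\<in>UNIV. axis (sym_diff A B) ((cl_sign A B * a $ B) *\<^sub>R (v $ A)))"

definition cl_real :: "real \<Rightarrow> 'n::{finite,linorder} clifford" where
  "cl_real x = axis {} x"

definition cl_gen :: "'n::{finite,linorder} \<Rightarrow> 'n clifford" where
  "cl_gen i = axis {i} 1"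

lemma cl_lmul_axis:
  fixes v :: "'v::real_normed_vector"
  shows "axis A a \<odot> axis B v = axis (sym_diff A B) ((cl_sign A B * a) *\<^sub>R v)"
proof -
  have "axis A a \<odot> axis B v =
      (\<Sum>A'\<in>UNIV. if A' = A then (\<Sum>B'\<in>UNIV. if B' = B
        then axis (sym_diff A B) ((cl_sign A B * a) *\<^sub>R v) else 0) else 0)"
    unfolding cl_lmul_def
  proof (intro sum.cong refl)
    fix A' :: "'a set"
    have "axis (sym_diff A' B') ((cl_sign A' B' * axis A a $ A') *\<^sub>R (axis B v $ B')) =
        (if A' = A then if B' = B then axis (sym_diff A B) ((cl_sign A B * a) *\<^sub>R v) else 0 else 0)"
      for B' by (cases "A' = A"; cases "B' = B") (simp_all add: axis_def zero_vec_def)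
    then show "(\<Sum>B'\<in>UNIV. axis (sym_diff A' B')
          ((cl_sign A' B' * axis A a $ A') *\<^sub>R (axis B v $ B'))) =
        (if A' = A then (\<Sum>B'\<in>UNIV. if B' = B
          then axis (sym_diff A B) ((cl_sign A B * a) *\<^sub>R v) else 0) else 0)"
      by simp
  qed
  then show ?thesis by simp
qed

lemma cl_lmul_eq_rmul: "a \<odot> b = a \<odot>\<^sub>r b" for a b :: "'n::{finite,linorder} clifford"
  unfolding cl_lmul_def cl_rmul_def by (simp add: mult_ac)

lemma cl_gen_sq: "cl_gen i \<odot> cl_gen i = cl_real (-1)"
proof -
  have "{(k, j). k \<in> {i} \<and> j \<in> {i} \<and> j \<le> k} = {(i, i)}" by auto
  then show ?thesis
    by (simp add: cl_gen_def cl_real_def cl_lmul_axis cl_sign_def)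
qed

lemma cl_gen_anticomm:
  fixes i j :: "'n::{finite,linorder}"
  assumes "i \<noteq> j"
  shows "cl_gen i \<odot> cl_gen j = - (cl_gen j \<odot> cl_gen i)"
proof -
  have *: "cl_sign {i} {j} = (if j \<le> i then -1 else 1)" for i j :: 'n
  proof -
    have "{(k, l). k \<in> {i} \<and> l \<in> {j} \<and> l \<le> k} = (if j \<le> i then {(i, j)} else {})" by auto
    then show ?thesis by (simp add: cl_sign_def)
  qed
  have "sym_diff {i} {j} = {i, j}" "sym_diff {j} {i} = {i, j}" using assms by auto
  moreover have "j \<le> i \<longleftrightarrow> \<not> i \<le> j" using assms by auto
  ultimately show ?thesis
    unfolding cl_gen_def cl_lmul_axis * by (simp add: axis_def vec_eq_iff)
qed

lemma cl_gen_insert: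
  assumes "\<And>j. j \<in> A \<Longrightarrow> i < j"
  shows "cl_gen i \<odot> axis A (1::real) = axis (insert i A) 1"
proof -
  have "{(k, j). k \<in> {i} \<and> j \<in> A \<and> j \<le> k} = {}" using assms by fastforce
  then have "cl_sign {i} A = 1" unfolding cl_sign_def by (simp only: card.empty power_0)
  moreover have "sym_diff {i} A = insert i A" using assms by fastforce
  ultimately show ?thesis by (simp add: cl_gen_def cl_lmul_axis)
qed

definition paravectors :: "'n::{finite,linorder} clifford set" where
  "paravectors = {s. \<forall>A. card A > 1 \<longrightarrow> s $ A = 0}"

text \<open>Conjugate and inverse are meant for paravectors only.\<close>

definition cl_conj :: "'n::{finite,linorder} clifford \<Rightarrow> 'n clifford" where
  "cl_conj s = (\<chi> A. if A = {} then s $ A else - (s $ A))"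

definition cl_inv :: "'n::{finite,linorder} clifford \<Rightarrow> 'n clifford" where
  "cl_inv s = (1 / (norm s)\<^sup>2) *\<^sub>R cl_conj s"

definition imag_sphere :: "'n::{finite,linorder} clifford set" where
  "imag_sphere = {s \<in> paravectors. s $ {} = 0 \<and> norm s = 1}"

text \<open>\<open>cl_cis J \<phi>\<close> is \<open>exp (J\<phi>)\<close> for \<open>J\<close> in the sphere of imaginary units.\<close>

definition cl_cis :: "'n::{finite,linorder} clifford \<Rightarrow> real \<Rightarrow> 'n clifford" where
  "cl_cis J \<phi> = cl_real (cos \<phi>) + sin \<phi> *\<^sub>R J"

definition angle_set :: "real \<Rightarrow> real set" where
  "angle_set \<omega> = {- \<omega> <..< \<omega>} \<union> {pi - \<omega> <..< pi + \<omega>}"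

definition double_sector :: "real \<Rightarrow> 'n::{finite,linorder} clifford set" where
  "double_sector \<omega> = {r *\<^sub>R cl_cis J \<phi> |r J \<phi>. r > 0 \<and> J \<in> imag_sphere \<and> \<phi> \<in> angle_set \<omega>}"

definition slice_domain :: "'n::{finite,linorder} clifford set \<Rightarrow> (real \<times> real) set" where
  "slice_domain U = {(x, y). \<forall>J\<in>imag_sphere. cl_real x + y *\<^sub>R J \<in> U}"

text \<open>
  Meant for \<open>U\<close> open and axially symmetric in the space of paravectors; it is used for double
  sectors only.  Functions on \<open>U\<close> are total functions of which only the values on \<open>U\<close> matter.
  Continuous differentiability is total differentiability on the open set \<open>slice_domain U\<close> with
  continuous partial derivatives.
\<close>

definition slice_components ::
  "'n::{finite,linorder} clifford set \<Rightarrow> ('n clifford \<Rightarrow> 'n clifford)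
    \<Rightarrow> (real \<times> real \<Rightarrow> 'n clifford) \<Rightarrow> (real \<times> real \<Rightarrow> 'n clifford) \<Rightarrow> bool" where
  "slice_components U f f0 f1 \<longleftrightarrow>
    (\<forall>(x, y) \<in> slice_domain U.
        (\<forall>J\<in>imag_sphere. f (cl_real x + y *\<^sub>R J) = f0 (x, y) + J \<odot> f1 (x, y)) \<and>
        f0 (x, - y) = f0 (x, y) \<and> f1 (x, - y) = - f1 (x, y)) \<and>
    (\<exists>f0x f0y f1x f1y.
        continuous_on (slice_domain U) f0x \<and> continuous_on (slice_domain U) f0y \<and>
        continuous_on (slice_domain U) f1x \<and> continuous_on (slice_domain U) f1y \<and>
        (\<forall>p \<in> slice_domain U.
          (f0 has_derivative (\<lambda>(h, k). h *\<^sub>R f0x p + k *\<^sub>R f0y p)) (at p) \<and>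
          (f1 has_derivative (\<lambda>(h, k). h *\<^sub>R f1x p + k *\<^sub>R f1y p)) (at p) \<and>
          f0x p = f1y p \<and> f0y p = - f1x p))"

definition SH_L :: "'n::{finite,linorder} clifford set \<Rightarrow> ('n clifford \<Rightarrow> 'n clifford) set" where
  "SH_L U = {f. \<exists>f0 f1. slice_components U f f0 f1}"

definition intrinsic :: "'n::{finite,linorder} clifford set \<Rightarrow> ('n clifford \<Rightarrow> 'n clifford) set" where
  "intrinsic U = {f. \<exists>f0 f1. slice_components U f f0 f1 \<and>
    (\<forall>p \<in> slice_domain U. f0 p \<in> range cl_real \<and> f1 p \<in> range cl_real)}"

definition SH_L0 :: "real \<Rightarrow> ('n::{finite,linorder} clifford \<Rightarrow> 'n clifford) set" where
  "SH_L0 \<theta> = {f \<in> SH_L (double_sector \<theta>).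
    bounded (f ` double_sector \<theta>) \<and>
    (\<forall>J\<in>imag_sphere. \<forall>\<phi>\<in>angle_set \<theta>.
      (\<integral>\<^sup>+t\<in>{0<..}. ennreal (norm (f (t *\<^sub>R cl_cis J \<phi>)) / t) \<partial>lborel) < \<infinity>)}"

definition intrinsic0 :: "real \<Rightarrow> ('n::{finite,linorder} clifford \<Rightarrow> 'n clifford) set" where
  "intrinsic0 \<theta> = SH_L0 \<theta> \<inter> intrinsic (double_sector \<theta>)"

text \<open>
  Operators are partial maps: their domain is \<^const>\<open>dom\<close>, the product with natural domain is
  \<^const>\<open>map_comp\<close> (\<open>\<circ>\<^sub>m\<close>) and the extension relation is \<^const>\<open>map_le\<close> (\<open>\<subseteq>\<^sub>m\<close>).
\<close>

type_synonym ('v, 'n) cl_op = "('v, 'n) cl_module \<rightharpoonup> ('v, 'n) cl_module"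

text \<open>The case \<open>a \<in> \<real>\<close> of right homogeneity makes these operators real linear.\<close>

definition right_linear :: "('v::banach, 'n::{finite,linorder}) cl_op \<Rightarrow> bool" where
  "right_linear T \<longleftrightarrow> T 0 = Some 0 \<and>
    (\<forall>v w x y. T v = Some x \<longrightarrow> T w = Some y \<longrightarrow> T (v + w) = Some (x + y)) \<and>
    (\<forall>v x a. T v = Some x \<longrightarrow> T (v \<odot>\<^sub>r a) = Some (x \<odot>\<^sub>r a))"

definition closed_ops :: "('v::banach, 'n::{finite,linorder}) cl_op set" where
  "closed_ops = {T. right_linear T \<and> closed {(v, w). T v = Some w}}"

definition bounded_ops :: "('v::banach, 'n::{finite,linorder}) cl_op set" where
  "bounded_ops = {T. right_linear T \<and> dom T = UNIV \<and>
    (\<exists>K. \<forall>v. norm (the (T v)) \<le> K * norm v)}"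

text \<open>
  \<open>to_blinfun\<close> and \<open>of_blinfun\<close> pass between everywhere defined bounded operators as partial
  maps and as elements of the Banach space of bounded linear operators.
\<close>

definition to_blinfun ::
  "('v::banach, 'n::{finite,linorder}) cl_op \<Rightarrow> ('v, 'n) cl_module \<Rightarrow>\<^sub>L ('v, 'n) cl_module" where
  "to_blinfun X = Blinfun (\<lambda>v. the (X v))"

definition of_blinfun ::
  "(('v::banach, 'n::{finite,linorder}) cl_module \<Rightarrow>\<^sub>L ('v, 'n) cl_module) \<Rightarrow> ('v, 'n) cl_op" where
  "of_blinfun X = (\<lambda>v. Some (blinfun_apply X v))"

definition lmul_op :: "'n::{finite,linorder} clifford \<Rightarrow> ('v::banach, 'n) cl_op" where
  "lmul_op a = (\<lambda>v. Some (a \<odot> v))"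

definition op_minus ::
  "('v::banach, 'n::{finite,linorder}) cl_op \<Rightarrow> ('v, 'n) cl_op \<Rightarrow> ('v, 'n) cl_op" where
  "op_minus X Y = (\<lambda>v. case (X v, Y v) of (Some x, Some y) \<Rightarrow> Some (x - y) | _ \<Rightarrow> None)"

text \<open>The inverse, defined on the range; meaningful for injective operators.\<close>

definition op_inverse :: "('v::banach, 'n::{finite,linorder}) cl_op \<Rightarrow> ('v, 'n) cl_op" where
  "op_inverse X = (\<lambda>w. if \<exists>v. X v = Some w then Some (THE v. X v = Some w) else None)"

definition Q_op ::
  "'n::{finite,linorder} clifford \<Rightarrow> ('v::banach, 'n) cl_op \<Rightarrow> ('v, 'n) cl_op" where
  "Q_op s T = (\<lambda>v. map_option
    (\<lambda>w. w - (2 * s $ {}) *\<^sub>R the (T v) + (norm s)\<^sup>2 *\<^sub>R v) ((T \<circ>\<^sub>m T) v))"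

abbreviation Q_inv ::
  "'n::{finite,linorder} clifford \<Rightarrow> ('v::banach, 'n) cl_op \<Rightarrow> ('v, 'n) cl_op" where
  "Q_inv s T \<equiv> op_inverse (Q_op s T)"

definition S_resolvent_set ::
  "('v::banach, 'n::{finite,linorder}) cl_op \<Rightarrow> 'n clifford set" where
  "S_resolvent_set T =
    {s \<in> paravectors. inj_on (Q_op s T) (dom (Q_op s T)) \<and> Q_inv s T \<in> bounded_ops}"

definition S_spectrum :: "('v::banach, 'n::{finite,linorder}) cl_op \<Rightarrow> 'n clifford set" where
  "S_spectrum T = paravectors - S_resolvent_set T"

definition S_L_inv ::
  "'n::{finite,linorder} clifford \<Rightarrow> ('v::banach, 'n) cl_op \<Rightarrow> ('v, 'n) cl_op" where
  "S_L_inv s T = op_minus (Q_inv s T \<circ>\<^sub>m lmul_op (cl_conj s)) (T \<circ>\<^sub>m Q_inv s T)"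

text \<open>
  The first condition makes \<open>S_L_inv s T\<close> everywhere defined at all \<open>s\<close> of the second one; the
  bound on its operator norm is written out as \<open>\<parallel>S v\<parallel> \<le> (C / \<bar>s\<bar>) \<parallel>v\<parallel>\<close> for all \<open>v\<close>.
\<close>

definition bisectorial :: "real \<Rightarrow> ('v::banach, 'n::{finite,linorder}) cl_op \<Rightarrow> bool" where
  "bisectorial \<omega> T \<longleftrightarrow> T \<in> closed_ops \<and>
    S_spectrum T \<subseteq> closure (double_sector \<omega>) \<and>
    (\<forall>\<phi>\<in>{\<omega> <..< pi / 2}. \<exists>C\<ge>0. \<forall>s \<in> paravectors - (double_sector \<phi> \<union> {0}).
      \<forall>v. norm (the (S_L_inv s T v)) \<le> C / norm s * norm v)"

definition sector_path :: "'n::{finite,linorder} clifford \<Rightarrow> real \<Rightarrow> real \<Rightarrow> real \<Rightarrow> 'n clifford" where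
  "sector_path J \<phi> \<epsilon> t = (\<epsilon> * \<bar>t\<bar>) *\<^sub>R cl_cis J (- (sgn t * \<phi>))"

text \<open>
  The operator valued integral over \<open>\<real>\<close>, taken in the operator norm, is the library's
  Henstock-Kurzweil integral, because the library's Bochner integral is confined to separable
  spaces.  Every Bochner integrable function is Henstock-Kurzweil integrable with the same
  integral.  The integrand at the single point \<open>t = 0\<close> is irrelevant.  The result depends
  neither on \<open>\<phi> \<in> (\<omega>, \<theta>)\<close> nor on \<open>J\<close>; both are kept as parameters.
\<close>

definition omega_calc ::
  "'n::{finite,linorder} clifford \<Rightarrow> real \<Rightarrow> ('n clifford \<Rightarrow> 'n clifford) \<Rightarrow> ('v::banach, 'n) cl_op
    \<Rightarrow> ('v, 'n) cl_module \<Rightarrow>\<^sub>L ('v, 'n) cl_module" where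
  "omega_calc J \<phi> f T = (1 / (2 * pi)) *\<^sub>R (\<Sum>\<epsilon>\<in>{1, -1}. integral UNIV (\<lambda>t.
    to_blinfun (S_L_inv (sector_path J \<phi> \<epsilon> t) T \<circ>\<^sub>m
      lmul_op ((vector_derivative (sector_path J \<phi> \<epsilon>) (at t) \<odot> cl_inv J) \<odot>
        f (sector_path J \<phi> \<epsilon> t)))))"

text \<open>\<open>bnd_components \<theta> g (g0, ginf, gt)\<close>: here \<open>g0\<close> and \<open>ginf\<close> are the values at \<open>0\<close> and \<open>\<infinity>\<close>.\<close>

definition bnd_components ::
  "real \<Rightarrow> ('n::{finite,linorder} clifford \<Rightarrow> 'n clifford)
    \<Rightarrow> real \<times> real \<times> ('n clifford \<Rightarrow> 'n clifford) \<Rightarrow> bool" where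
  "bnd_components \<theta> g = (\<lambda>(g0, ginf, gt). gt \<in> intrinsic0 \<theta> \<and>
    (\<forall>s \<in> double_sector \<theta>.
      g s = cl_real ginf + (g0 - ginf) *\<^sub>R cl_inv (cl_real 1 + s \<odot> s) + gt s))"

definition intrinsic_bnd :: "real \<Rightarrow> ('n::{finite,linorder} clifford \<Rightarrow> 'n clifford) set" where
  "intrinsic_bnd \<theta> = {g. \<exists>c. bnd_components \<theta> g c}"

definition one_plus_sq :: "('v::banach, 'n::{finite,linorder}) cl_op \<Rightarrow> ('v, 'n) cl_op" where
  "one_plus_sq T = (\<lambda>v. map_option (\<lambda>w. v + w) ((T \<circ>\<^sub>m T) v))"

lemma one_plus_sq_eq_Q_op:
  assumes "J \<in> imag_sphere"
  shows "one_plus_sq T = Q_op J T"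
  using assms by (auto simp: one_plus_sq_def Q_op_def imag_sphere_def add.commute)

text \<open>
  The components of \<open>g\<close> are unique, the function \<open>gt\<close> up to its irrelevant values outside the
  double sector; so the choice below does not influence the result.
\<close>

definition ext_omega_calc ::
  "real \<Rightarrow> 'n::{finite,linorder} clifford \<Rightarrow> real \<Rightarrow> ('n clifford \<Rightarrow> 'n clifford)
    \<Rightarrow> ('v::banach, 'n) cl_op \<Rightarrow> ('v, 'n) cl_op" where
  "ext_omega_calc \<theta> J \<phi> g T = (case SOME c. bnd_components \<theta> g c of (g0, ginf, gt) \<Rightarrow>
    of_blinfun (ginf *\<^sub>R id_blinfun + (g0 - ginf) *\<^sub>R to_blinfun (op_inverse (one_plus_sq T))
      + omega_calc J \<phi> gt T))"

end

(*
  Pairing the parameters t and -t on the boundary of the sector pairs s with its conjugate, and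
  Q_s[T] is the same for both. For intrinsic f the coefficients of the two integrands are conjugate
  in C_J, so their sum is a real linear combination of Q_s[T]^{-1} and T Q_s[T]^{-1}: no Clifford
  number is left that A would have to commute with. The graph of A is a closed real subspace, and
  such a subspace contains the integral of every function with values in it.
*)

theory Submission
  imports Defs
begin

text \<open>The obstacle is that \<open>A\<close> is only right linear: it need not commute with
  left multiplication by the conjugate of s, by ds_J or by f(s), so a single value of the integrand
  need not commute with \<open>A\<close>. Pairing helps because two conjugations fit together. The
  values of f are conjugate since its components are real, one even and one odd in y. The factor
  ds_J = ds/J is conjugate as well: the derivatives of the path at t and -t are conjugate up to a
  sign, and so are 1/J and its conjugate, so the two signs cancel. The integrand passes through
  \<open>to_blinfun\<close>, which has a meaning only for bounded linear maps; the estimate in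
  \<open>bisectorial\<close> supplies that boundedness. Membership in the sectors is decided by
  comparing the modulus of s_0 with cos \<omega> times the norm of s, an inequality that survives
  passage to the closure. The term with (1 + T^2)^{-1} is the first commutation hypothesis at s = J,
  because J has s_0 = 0 and norm 1.\<close>

section \<open>Integrals with values in a closed subspace\<close>

text \<open>Riemann sums are linear combinations of values of \<open>f\<close>, so they lie in
  \<open>S\<close>. The integral over a box is their limit, and the integral over the whole space is
  approximated by integrals over large boxes; closedness is used for both limits.\<close>

lemma closed_subspace_has_integral:
  fixes f :: "'a::euclidean_space \<Rightarrow> 'b::real_normed_vector"
  assumes "closed S" "subspace S" "\<And>x. f x \<in> S" "(f has_integral i) UNIV"
  shows "i \<in> S"
proof -
  have cbox: "z \<in> S" if "(f has_integral z) (cbox a b)" for z a b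
  proof (rule Lim_in_closed_set)
    show "((\<lambda>p. \<Sum>(x, k)\<in>p. measure lborel k *\<^sub>R f x) \<longlongrightarrow> z) (division_filter (cbox a b))"
      using that by (simp add: has_integral_cbox)
    show "\<forall>\<^sub>F p in division_filter (cbox a b). (\<Sum>(x, k)\<in>p. measure lborel k *\<^sub>R f x) \<in> S"
      by (intro always_eventually allI subspace_sum assms)
        (auto intro!: subspace_scale assms)
  qed (use assms(1) division_filter_not_empty in auto)
  have "\<exists>z\<in>S. dist z i < e" if "e > 0" for e
  proof -
    have "\<not> (\<exists>a b. (UNIV :: 'a set) = cbox a b)" using not_bounded_UNIV bounded_cbox by metis
    then obtain B where B: "\<forall>a b. ball 0 B \<subseteq> cbox a b \<longrightarrow>
        (\<exists>z. ((\<lambda>x. if x \<in> UNIV then f x else 0) has_integral z) (cbox a b) \<and> norm (z - i) < e)"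
      using has_integral_altD[OF assms(4) _ \<open>e > 0\<close>] by metis
    obtain a b :: 'a where ab: "ball 0 B \<subseteq> cbox a b"
      using bounded_subset_cbox_symmetric[OF bounded_ball] by metis
    then obtain z where z: "(f has_integral z) (cbox a b)" "norm (z - i) < e"
      using B[rule_format, OF ab] by auto
    from cbox[OF z(1)] z(2) show ?thesis by (auto simp: dist_norm)
  qed
  then show ?thesis using assms(1) closure_approachable[of i S] by auto
qed

text \<open>Balls around 0 are symmetric, so a box contains one exactly if the reflected box does.
  This carries reflection from boxes to the whole line, as the pairing of t with -t
  requires.\<close>

lemma has_integral_reflect_UNIV:
  fixes f :: "real \<Rightarrow> 'b::real_normed_vector"
  assumes "(f has_integral i) UNIV"
  shows "((\<lambda>x. f (- x)) has_integral i) UNIV"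
proof -
  have no: "\<not> (\<exists>a b. (UNIV :: real set) = cbox a b)" using not_bounded_UNIV bounded_cbox by metis
  have "\<exists>B>0. \<forall>a b. ball 0 B \<subseteq> cbox a b \<longrightarrow>
      (\<exists>z. ((\<lambda>x. f (- x)) has_integral z) (cbox a b) \<and> norm (z - i) < e)" if "e > 0" for e
  proof -
    obtain B where B: "B > 0" "\<forall>a b. ball 0 B \<subseteq> cbox a b \<longrightarrow>
        (\<exists>z. ((\<lambda>x. if x \<in> UNIV then f x else 0) has_integral z) (cbox a b) \<and> norm (z - i) < e)"
      using has_integral_altD[OF assms no \<open>e > 0\<close>] by metis
    have "\<exists>z. ((\<lambda>x. f (- x)) has_integral z) (cbox a b) \<and> norm (z - i) < e"
      if "ball 0 B \<subseteq> cbox a b" for a b :: real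
    proof -
      have ab: "ball 0 B \<subseteq> cbox (- b) (- a)"
      proof
        fix x :: real
        assume "x \<in> ball 0 B"
        then have "- x \<in> ball 0 B" by simp
        then have "- x \<in> cbox a b" using that by blast
        then show "x \<in> cbox (- b) (- a)" by auto
      qed
      then obtain z where "(f has_integral z) (cbox (- b) (- a))" "norm (z - i) < e"
        using B(2)[rule_format, OF ab] by auto
      then show ?thesis using has_integral_reflect_lemma[of f z "- b" "- a"] by auto
    qed
    then show ?thesis using B(1) by blast
  qed
  then show ?thesis by (subst has_integral_alt) (use no in auto)
qed

section \<open>The Clifford module\<close>

lemma axis_linear: "linear (axis k :: 'a::real_normed_vector \<Rightarrow> 'a ^ 'm::finite)"
  by (rule linearI) (auto simp: axis_def vec_eq_iff)

lemmas axis_add = linear_add[OF axis_linear]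
lemmas axis_scaleR = linear_scale[OF axis_linear]

lemma sum_axis: "(\<Sum>k\<in>UNIV. axis k (v $ k)) = (v :: 'a::real_normed_vector ^ 'm::finite)"
  by (simp add: vec_eq_iff axis_def)

lemma bounded_linear_axis:
  "bounded_linear (axis k :: 'a::real_normed_vector \<Rightarrow> 'a ^ 'm::finite)"
proof (rule bounded_linear_intro[where K = 1])
  show "norm (axis k x :: 'a ^ 'm) \<le> norm x * 1" for x :: 'a
    unfolding norm_vec_def
    by (rule order_trans[OF L2_set_le_sum]) (simp_all add: axis_def if_distrib[of norm] cong: if_cong)
qed (simp_all add: axis_add axis_scaleR)

text \<open>
  As a product over pairs, the sign is multiplicative in each argument with respect to symmetric
  difference. This makes it a cocycle, which gives associativity.
\<close>

lemma cl_sign_eq_prod: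
  "cl_sign A B = (\<Prod>i\<in>A. \<Prod>j\<in>B. if j \<le> i then - 1 else 1)"
proof -
  have "{(i, j). i \<in> A \<and> j \<in> B \<and> j \<le> i} = {p \<in> A \<times> B. snd p \<le> fst p}" by auto
  moreover have "(\<Prod>p\<in>A \<times> B. if snd p \<le> fst p then - 1 else 1 :: real)
      = (- 1) ^ card {p \<in> A \<times> B. snd p \<le> fst p}"
    by (simp add: prod.If_cases Int_def)
  ultimately show ?thesis
    unfolding cl_sign_def by (simp add: prod.cartesian_product case_prod_beta)
qed

text \<open>The factors over the intersection occur twice on the right, and their squares are
  1.\<close>

lemma prod_sym_diff:
  fixes p :: "'i::finite \<Rightarrow> real"
  assumes "\<And>i. p i * p i = 1"
  shows "prod p (sym_diff A B) = prod p A * prod p B"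
proof -
  have "prod p A = prod p (A - B) * prod p (A \<inter> B)" "prod p B = prod p (B - A) * prod p (A \<inter> B)"
    by (subst prod.union_disjoint[symmetric]; auto intro!: prod.cong)+
  moreover have "prod p (sym_diff A B) = prod p (A - B) * prod p (B - A)"
    by (rule prod.union_disjoint) auto
  moreover have "prod p (A \<inter> B) * prod p (A \<inter> B) = 1"
    by (simp add: prod.distrib[symmetric] assms)
  ultimately show ?thesis by (simp add: mult_ac)
qed

lemma cl_sign_sym_diff_left: "cl_sign (sym_diff A B) C = cl_sign A C * cl_sign B C"
  unfolding cl_sign_eq_prod by (rule prod_sym_diff) (auto simp flip: prod.distrib intro!: prod.neutral)

lemma cl_sign_sym_diff_right: "cl_sign A (sym_diff B C) = cl_sign A B * cl_sign A C"
proof -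
  have "(\<Prod>j\<in>sym_diff B C. if j \<le> i then - 1 else 1 :: real)
      = (\<Prod>j\<in>B. if j \<le> i then - 1 else 1) * (\<Prod>j\<in>C. if j \<le> i then - 1 else 1)" for i :: 'a
    by (rule prod_sym_diff) simp
  then show ?thesis unfolding cl_sign_eq_prod by (simp add: prod.distrib)
qed

lemma cl_sign_empty [simp]: "cl_sign A {} = 1" "cl_sign {} A = 1"
  by (simp_all add: cl_sign_eq_prod)

lemma cl_lmul_add_left: "(a + b) \<odot> v = a \<odot> v + b \<odot> v"
  by (simp add: cl_lmul_def algebra_simps axis_add sum.distrib)

lemma cl_lmul_add_right: "a \<odot> (v + w) = a \<odot> v + a \<odot> w"
  by (simp add: cl_lmul_def algebra_simps axis_add sum.distrib)

lemma cl_lmul_scaleR_left: "(r *\<^sub>R a) \<odot> v = r *\<^sub>R (a \<odot> v)"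
  by (simp add: cl_lmul_def mult.left_commute scaleR_sum_right flip: axis_scaleR)

lemma cl_lmul_scaleR_right: "a \<odot> (r *\<^sub>R v) = r *\<^sub>R (a \<odot> v)"
  by (simp add: cl_lmul_def mult_ac scaleR_sum_right flip: axis_scaleR)

lemma linear_cl_lmul_left: "linear (\<lambda>a. a \<odot> v)"
  by (rule linearI) (simp_all add: cl_lmul_add_left cl_lmul_scaleR_left)

lemma linear_cl_lmul_right: "linear (\<lambda>v. a \<odot> v)"
  by (rule linearI) (simp_all add: cl_lmul_add_right cl_lmul_scaleR_right)

text \<open>The coordinates of \<open>v\<close> may lie in an infinite dimensional space, so
  boundedness does not follow from linearity; it comes from the finite sum of bounded maps.\<close>

lemma bounded_linear_cl_lmul:
  "bounded_linear (\<lambda>v. a \<odot> v :: ('v::real_normed_vector, 'n::{finite,linorder}) cl_module)"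
  unfolding cl_lmul_def
  by (intro bounded_linear_sum bounded_linear_compose[OF bounded_linear_axis]
      bounded_linear_compose[OF bounded_linear_scaleR_right] bounded_linear_vec_nth)

lemma cl_lmul_assoc: "(a \<odot> b) \<odot> v = a \<odot> (b \<odot> v)"
proof -
  \<comment> \<open>Multilinearity reduces the claim to basis elements, where both sides carry the
    sign \<open>cl_sign A B * cl_sign A C * cl_sign B C\<close>.\<close>
  have basis: "(axis A x \<odot> axis B y) \<odot> axis C w = axis A x \<odot> (axis B y \<odot> axis C w)"
    for A B C :: "'b set" and x y and w :: 'a
  proof -
    have "sym_diff (sym_diff A B) C = sym_diff A (sym_diff B C)" by auto
    then show ?thesis
      by (simp only: cl_lmul_axis cl_sign_sym_diff_left cl_sign_sym_diff_right
          real_scaleR_def scaleR_scaleR mult_ac)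
  qed
  have "(a \<odot> b) \<odot> v = ((\<Sum>A\<in>UNIV. axis A (a $ A)) \<odot> (\<Sum>B\<in>UNIV. axis B (b $ B)))
      \<odot> (\<Sum>C\<in>UNIV. axis C (v $ C))"
    by (simp only: sum_axis)
  also have "\<dots> = (\<Sum>A\<in>UNIV. axis A (a $ A)) \<odot> ((\<Sum>B\<in>UNIV. axis B (b $ B))
      \<odot> (\<Sum>C\<in>UNIV. axis C (v $ C)))"
    by (simp only: linear_sum[OF linear_cl_lmul_left] linear_sum[OF linear_cl_lmul_right] basis)
  finally show ?thesis by (simp only: sum_axis)
qed

lemma cl_real_lmul: "cl_real r \<odot> v = r *\<^sub>R v"
proof -
  have "cl_real r \<odot> (\<Sum>B\<in>UNIV. axis B (v $ B)) = (\<Sum>B\<in>UNIV. r *\<^sub>R axis B (v $ B))"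
    by (simp add: linear_sum[OF linear_cl_lmul_right] cl_real_def cl_lmul_axis axis_scaleR)
  then show ?thesis by (simp add: sum_axis flip: scaleR_sum_right)
qed

lemma cl_rmul_real:
  fixes v :: "('v::real_normed_vector, 'n::{finite,linorder}) cl_module"
  shows "v \<odot>\<^sub>r cl_real r = r *\<^sub>R v"
proof -
  have "(\<Sum>B\<in>UNIV. axis (sym_diff A B) ((cl_sign A B * cl_real r $ B) *\<^sub>R (v $ A)))
      = r *\<^sub>R axis A (v $ A)" for A :: "'n set"
  proof -
    have "(\<Sum>B\<in>UNIV. axis (sym_diff A B) ((cl_sign A B * cl_real r $ B) *\<^sub>R (v $ A)))
      = (\<Sum>B\<in>UNIV. if B = ({} :: 'n set) then r *\<^sub>R axis A (v $ A) else 0)"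
    proof (intro sum.cong refl)
      show "axis (sym_diff A B) ((cl_sign A B * cl_real r $ B) *\<^sub>R (v $ A))
          = (if B = ({} :: 'n set) then r *\<^sub>R axis A (v $ A) else 0)" for B
        by (cases "B = {}") (simp_all add: cl_real_def axis_scaleR, simp add: axis_def vec_eq_iff)
    qed
    then show ?thesis by simp
  qed
  then have "v \<odot>\<^sub>r cl_real r = r *\<^sub>R (\<Sum>A\<in>UNIV. axis A (v $ A))"
    unfolding cl_rmul_def by (simp only: scaleR_sum_right)
  then show ?thesis by (simp only: sum_axis)
qed

text \<open>The nonzero coordinates of \<open>J\<close> sit at singletons. Adding the double sum for
  the square to its transpose cancels the mixed terms, since distinct generators anticommute, and
  leaves -2 times the squared norm of \<open>J\<close>.\<close>

lemma imag_unit_square: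
  assumes "J \<in> imag_sphere"
  shows "J \<odot> J = cl_real (- 1)"
proof -
  define s where "s A B = axis (sym_diff A B) (cl_sign A B * J $ A * J $ B)" for A B
  have JJ: "J \<odot> J = (\<Sum>A\<in>UNIV. \<Sum>B\<in>UNIV. s A B)"
    by (simp add: cl_lmul_def s_def)
  have card1: "card A = 1" if "J $ A \<noteq> 0" for A
  proof -
    have "A \<noteq> {}" "\<not> card A > 1" using that assms by (auto simp: imag_sphere_def paravectors_def)
    then have "card A \<noteq> 0" by simp
    with \<open>\<not> card A > 1\<close> show ?thesis by linarith
  qed
  have anti: "s A B + s B A = (if B = A then axis {} (- 2 * (J $ A)\<^sup>2) else 0)" for A B
  proof (cases "J $ A = 0 \<or> J $ B = 0")
    case True
    then have "s A B = 0" "s B A = 0" by (auto simp: s_def axis_def vec_eq_iff)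
    with True show ?thesis by (auto simp: axis_def vec_eq_iff)
  next
    case False
    then obtain i j where A: "A = {i}" and B: "B = {j}"
      using card1 by (meson card_1_singletonE)
    show ?thesis
    proof (cases "i = j")
      case True
      then show ?thesis
        by (simp add: A B s_def cl_sign_eq_prod power2_eq_square flip: axis_add)
    next
      case False
      have "sym_diff {j} {i} = sym_diff {i} {j}" by auto
      then have "s A B + s B A
          = axis (sym_diff {i} {j}) ((cl_sign {i} {j} + cl_sign {j} {i}) * J $ A * J $ B)"
        unfolding A B s_def by (simp only: flip: axis_add) (simp only: algebra_simps)
      also have "cl_sign {i} {j} + cl_sign {j} {i} = 0"
        using False by (auto simp: cl_sign_eq_prod)
      finally show ?thesis using False by (simp add: A B)
    qed
  qed
  have swap: "(\<Sum>A\<in>UNIV. \<Sum>B\<in>UNIV. s A B) = (\<Sum>A\<in>UNIV. \<Sum>B\<in>UNIV. s B A)"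
    by (rule sum.swap)
  have "2 *\<^sub>R (J \<odot> J) = (\<Sum>A\<in>UNIV. \<Sum>B\<in>UNIV. s A B) + (\<Sum>A\<in>UNIV. \<Sum>B\<in>UNIV. s B A)"
    unfolding JJ scaleR_2 swap ..
  also have "\<dots> = (\<Sum>A\<in>UNIV. axis {} (- 2 * (J $ A)\<^sup>2))"
    unfolding sum.distrib[symmetric] anti by simp
  also have "\<dots> = axis {} (- 2 * (\<Sum>A\<in>UNIV. (J $ A)\<^sup>2))"
    by (simp only: sum_distrib_left linear_sum[OF axis_linear])
  also have "(\<Sum>A\<in>UNIV. (J $ A)\<^sup>2) = 1"
    using assms by (simp add: imag_sphere_def norm_vec_def L2_set_def)
  also have "axis {} (- 2 * 1 :: real) = 2 *\<^sub>R cl_real (- 1)"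
    by (simp add: cl_real_def flip: axis_scaleR)
  finally show ?thesis by simp
qed

section \<open>The slices \<open>\<complex>\<^sub>J\<close>\<close>

text \<open>For \<open>J\<close> in the sphere this is the algebra embedding of the complex numbers
  with image C_J. It turns computations on a slice into complex arithmetic with \<open>cnj\<close>,
  \<open>cis\<close> and \<open>cmod\<close>.\<close>

definition cl_complex :: "'n::{finite,linorder} clifford \<Rightarrow> complex \<Rightarrow> 'n clifford" where
  "cl_complex J z = cl_real (Re z) + Im z *\<^sub>R J"

lemma cl_real_add: "cl_real (x + y) = cl_real x + cl_real y"
  by (simp add: cl_real_def axis_add)

lemma cl_real_scaleR: "cl_real (x * y) = x *\<^sub>R cl_real y"
  by (simp add: cl_real_def flip: axis_scaleR)

lemma cl_real_minus: "cl_real (- x) = - cl_real x"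
  using cl_real_scaleR[of "- 1" x] by simp

lemma lmul_cl_real: "a \<odot> cl_real x = x *\<^sub>R a"
  by (simp add: cl_lmul_eq_rmul cl_rmul_real)

lemma cl_complex_lmul: "cl_complex J z \<odot> v = Re z *\<^sub>R v + Im z *\<^sub>R (J \<odot> v)"
  by (simp add: cl_complex_def cl_lmul_add_left cl_lmul_scaleR_left cl_real_lmul)

lemma cl_complex_mult:
  assumes "J \<in> imag_sphere"
  shows "cl_complex J z \<odot> cl_complex J w = cl_complex J (z * w)"
proof -
  have re: "cl_real (Re z * Re w - Im z * Im w)
      = Re z *\<^sub>R cl_real (Re w) - Im z *\<^sub>R cl_real (Im w)"
    using cl_real_add[of "Re z * Re w" "- (Im z * Im w)"] by (simp add: cl_real_scaleR cl_real_minus)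
  have J: "J \<odot> cl_complex J w = Re w *\<^sub>R J - cl_real (Im w)"
    using assms
    by (simp add: cl_real_scaleR[of "Im w" 1, simplified, symmetric] cl_complex_def cl_lmul_add_right
        cl_lmul_scaleR_right lmul_cl_real imag_unit_square cl_real_minus)
  have "cl_complex J (z * w)
      = Re z *\<^sub>R cl_real (Re w) - Im z *\<^sub>R cl_real (Im w) + (Re z * Im w + Im z * Re w) *\<^sub>R J"
    by (simp add: cl_complex_def re)
  then show ?thesis
    unfolding cl_complex_lmul J by (simp add: cl_complex_def algebra_simps)
qed

text \<open>Here the Clifford number disappears: the two \<open>J\<close> terms are opposite, and
  what is left is a real scalar.\<close>

lemma cl_complex_add_cnj_lmul: "cl_complex J z \<odot> v + cl_complex J (cnj z) \<odot> v = (2 * Re z) *\<^sub>R v"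
  by (simp add: cl_complex_lmul scaleR_2 flip: scaleR_scaleR)

lemma cl_complex_of_real_mult: "cl_complex J (of_real r * z) = r *\<^sub>R cl_complex J z"
  by (simp add: cl_complex_def cl_real_scaleR algebra_simps)

lemma cl_cis_eq_cl_complex: "cl_cis J \<alpha> = cl_complex J (cis \<alpha>)"
  by (simp add: cl_cis_def cl_complex_def)

lemma cl_complex_nth_empty: "J \<in> imag_sphere \<Longrightarrow> cl_complex J z $ {} = Re z"
  by (simp add: cl_complex_def cl_real_def imag_sphere_def)

lemma cl_complex_in_paravectors: "J \<in> imag_sphere \<Longrightarrow> cl_complex J z \<in> paravectors"
  by (auto simp: cl_complex_def cl_real_def axis_def imag_sphere_def paravectors_def)

lemma cl_conj_cl_complex: "J \<in> imag_sphere \<Longrightarrow> cl_conj (cl_complex J z) = cl_complex J (cnj z)"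
  by (simp add: cl_conj_def cl_complex_def cl_real_def axis_def vec_eq_iff imag_sphere_def)

lemma cl_inv_imag_unit:
  assumes "J \<in> imag_sphere"
  shows "cl_inv J = cl_complex J (- \<i>)"
proof -
  have "cl_conj (cl_complex J \<i>) = cl_complex J (- \<i>)"
    using cl_conj_cl_complex[OF assms, of \<i>] by simp
  moreover have "cl_complex J \<i> = J" by (simp add: cl_complex_def cl_real_def)
  ultimately show ?thesis using assms by (simp add: cl_inv_def imag_sphere_def)
qed

lemma norm_cl_complex:
  assumes "J \<in> imag_sphere"
  shows "norm (cl_complex J z) = cmod z"
proof -
  have J: "J \<bullet> J = 1" "J $ {} = 0"
    using assms by (auto simp: imag_sphere_def norm_eq_1)
  have "cl_complex J z \<bullet> cl_complex J z = (Re z)\<^sup>2 + (Im z)\<^sup>2"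
    by (simp add: cl_complex_def cl_real_def inner_add_left inner_add_right inner_axis inner_axis' J
        power2_eq_square)
  then show ?thesis by (simp add: norm_eq_sqrt_inner[of "cl_complex J z"] cmod_def)
qed

section \<open>Geometry of the double sector and of its boundary path\<close>

text \<open>A point r exp(J\<alpha>) has real part r cos \<alpha> and norm r. On both intervals of
  \<open>angle_set\<close> the modulus of the cosine exceeds cos \<omega>; the second interval is
  the first one shifted by pi.\<close>

lemma double_sector_bound:
  assumes "0 < \<omega>" "\<omega> < pi / 2" "s \<in> double_sector \<omega>"
  shows "cos \<omega> * norm s < \<bar>s $ {}\<bar>"
proof -
  obtain r J \<alpha> where s: "s = r *\<^sub>R cl_cis J \<alpha>" "r > 0" "J \<in> imag_sphere" "\<alpha> \<in> angle_set \<omega>"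
    using assms(3) by (auto simp: double_sector_def)
  have *: "cos \<omega> < cos \<beta>" if "- \<omega> < \<beta>" "\<beta> < \<omega>" for \<beta>
    using that assms cos_monotone_0_pi[of "\<bar>\<beta>\<bar>" \<omega>] by auto
  have "cos \<omega> < \<bar>cos \<alpha>\<bar>"
    using s(4) *[of \<alpha>] *[of "\<alpha> - pi"] by (auto simp: angle_set_def)
  then show ?thesis
    using s by (simp add: cl_cis_eq_cl_complex norm_cl_complex cl_complex_nth_empty abs_mult
        mult.left_commute)
qed

lemma closure_double_sector_bound:
  assumes "0 < \<omega>" "\<omega> < pi / 2" "s \<in> closure (double_sector \<omega>)"
  shows "cos \<omega> * norm s \<le> \<bar>s $ {}\<bar>"
proof -
  have "closed {s :: 'a clifford. cos \<omega> * norm s \<le> \<bar>s $ {}\<bar>}"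
    by (intro closed_Collect_le continuous_intros)
  then have "closure (double_sector \<omega>) \<subseteq> {s :: 'a clifford. cos \<omega> * norm s \<le> \<bar>s $ {}\<bar>}"
    using double_sector_bound[OF assms(1,2)] by (intro closure_minimal) (auto intro: less_imp_le)
  then show ?thesis using assms(3) by auto
qed

definition sector_point :: "real \<Rightarrow> real \<Rightarrow> real \<Rightarrow> complex" where
  "sector_point \<phi> \<epsilon> t = of_real (\<epsilon> * \<bar>t\<bar>) * cis (- (sgn t * \<phi>))"

lemma sector_path_eq: "sector_path J \<phi> \<epsilon> t = cl_complex J (sector_point \<phi> \<epsilon> t)"
  by (simp only: sector_path_def sector_point_def cl_complex_of_real_mult cl_cis_eq_cl_complex)

lemma sector_point_minus: "sector_point \<phi> \<epsilon> (- t) = cnj (sector_point \<phi> \<epsilon> t)"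
  by (simp add: sector_point_def sgn_minus cis_cnj)

lemma cmod_sector_point: "\<epsilon> \<in> {1, -1} \<Longrightarrow> cmod (sector_point \<phi> \<epsilon> t) = \<bar>t\<bar>"
  by (auto simp: sector_point_def norm_mult)

lemma abs_Re_sector_point:
  assumes "\<epsilon> \<in> {1, -1}" "0 < \<phi>" "\<phi> < pi / 2"
  shows "\<bar>Re (sector_point \<phi> \<epsilon> t)\<bar> = cos \<phi> * \<bar>t\<bar>"
proof -
  have "cos (sgn t * \<phi>) * \<bar>t\<bar> = cos \<phi> * \<bar>t\<bar>"
    by (cases t "0::real" rule: linorder_cases) auto
  moreover have "cos \<phi> > 0" using assms by (intro cos_gt_zero) auto
  ultimately show ?thesis
    using assms(1) by (auto simp: sector_point_def abs_mult mult.commute)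
qed

text \<open>On the path the modulus of the real part equals cos \<phi> times the norm. This violates
  the weak inequality for the smaller angle \<omega> and the strict one for \<phi> itself. The first
  claim gives access to the resolvent set and to the commutation hypotheses, the second to the
  resolvent estimate.\<close>

lemma sector_path_notin:
  assumes "J \<in> imag_sphere" "\<epsilon> \<in> {1, -1}" "0 < \<omega>" "\<omega> < \<phi>" "\<phi> < pi / 2" "t \<noteq> 0"
  shows "sector_path J \<phi> \<epsilon> t \<in> paravectors - closure (double_sector \<omega>)"
    and "sector_path J \<phi> \<epsilon> t \<in> paravectors - (double_sector \<phi> \<union> {0})"
proof -
  have s: "norm (sector_path J \<phi> \<epsilon> t) = \<bar>t\<bar>" "\<bar>sector_path J \<phi> \<epsilon> t $ {}\<bar> = cos \<phi> * \<bar>t\<bar>"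
    using assms
    by (simp_all add: sector_path_eq norm_cl_complex cmod_sector_point cl_complex_nth_empty
        abs_Re_sector_point)
  have "cos \<phi> < cos \<omega>" using assms by (intro cos_monotone_0_pi) auto
  then have "\<not> cos \<omega> * \<bar>t\<bar> \<le> cos \<phi> * \<bar>t\<bar>" using assms(6) by simp
  then show "sector_path J \<phi> \<epsilon> t \<in> paravectors - closure (double_sector \<omega>)"
    using closure_double_sector_bound[of \<omega> "sector_path J \<phi> \<epsilon> t"] assms s
    by (auto simp: sector_path_eq cl_complex_in_paravectors)
  show "sector_path J \<phi> \<epsilon> t \<in> paravectors - (double_sector \<phi> \<union> {0})"
    using double_sector_bound[of \<phi> "sector_path J \<phi> \<epsilon> t"] assms s
    by (auto simp: sector_path_eq cl_complex_in_paravectors)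
qed

lemma sector_point_in_slice_domain:
  assumes "\<epsilon> \<in> {1, -1}" "0 < \<phi>" "\<phi> < \<theta>" "t \<noteq> 0"
  shows "(Re (sector_point \<phi> \<epsilon> t), Im (sector_point \<phi> \<epsilon> t)) \<in> slice_domain (double_sector \<theta>)"
proof -
  have sgn: "sgn t = 1 \<or> sgn t = - 1" using assms(4) by (simp add: sgn_real_def)
  obtain \<alpha> where \<alpha>: "\<alpha> \<in> angle_set \<theta>" "sector_point \<phi> \<epsilon> t = of_real \<bar>t\<bar> * cis \<alpha>"
  proof (cases "\<epsilon> = 1")
    case True
    show thesis
      by (rule that[of "- (sgn t * \<phi>)"]) (use True sgn assms in \<open>auto simp: sector_point_def angle_set_def\<close>)
  next
    case False
    then have "\<epsilon> = - 1" using assms(1) by simp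
    show thesis
      \<comment> \<open>The factor -1 is absorbed into the angle as a rotation by pi.\<close>
      by (rule that[of "pi - sgn t * \<phi>"])
        (use \<open>\<epsilon> = - 1\<close> sgn assms in \<open>auto simp: sector_point_def angle_set_def complex_eq_iff\<close>)
  qed
  have "cl_real (Re (sector_point \<phi> \<epsilon> t)) + Im (sector_point \<phi> \<epsilon> t) *\<^sub>R I \<in> double_sector \<theta>"
    if "I \<in> imag_sphere" for I :: "'a clifford"
  proof -
    have "cl_real (Re (sector_point \<phi> \<epsilon> t)) + Im (sector_point \<phi> \<epsilon> t) *\<^sub>R I = \<bar>t\<bar> *\<^sub>R cl_cis I \<alpha>"
      unfolding cl_complex_def[symmetric] \<alpha>(2) cl_complex_of_real_mult cl_cis_eq_cl_complex ..
    then show ?thesis using that \<alpha>(1) assms(4) unfolding double_sector_def by fastforce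
  qed
  then show ?thesis by (simp add: slice_domain_def)
qed

lemma vector_derivative_sector_path:
  assumes "t \<noteq> 0"
  shows "vector_derivative (sector_path J \<phi> \<epsilon>) (at t)
    = cl_complex J (of_real (\<epsilon> * sgn t) * cis (- (sgn t * \<phi>)))"
proof -
  define \<sigma> where "\<sigma> = sgn t"
  \<comment> \<open>The path has a corner at 0, but on the open half line containing
    \<open>t\<close> the modulus of u is \<sigma> u, so there the path is linear.\<close>
  have "((\<lambda>u. u *\<^sub>R (\<epsilon> * \<sigma>) *\<^sub>R cl_cis J (- (\<sigma> * \<phi>))) has_vector_derivative
      1 *\<^sub>R (\<epsilon> * \<sigma>) *\<^sub>R cl_cis J (- (\<sigma> * \<phi>))) (at t)"
    by (auto intro!: derivative_eq_intros)
  moreover have "open {u. 0 < \<sigma> * u}" by (intro open_Collect_less continuous_intros)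
  moreover have "t \<in> {u. 0 < \<sigma> * u}" using assms by (simp add: \<sigma>_def sgn_real_def)
  moreover have "u *\<^sub>R (\<epsilon> * \<sigma>) *\<^sub>R cl_cis J (- (\<sigma> * \<phi>)) = sector_path J \<phi> \<epsilon> u"
    if "u \<in> {u. 0 < \<sigma> * u}" for u
    using that assms
    by (auto simp: sector_path_def \<sigma>_def sgn_real_def mult_less_0_iff split: if_splits)
  ultimately have "(sector_path J \<phi> \<epsilon> has_vector_derivative
      1 *\<^sub>R (\<epsilon> * \<sigma>) *\<^sub>R cl_cis J (- (\<sigma> * \<phi>))) (at t)"
    by (rule has_vector_derivative_transform_within_open)
  then show ?thesis
    unfolding \<sigma>_def by (simp only: vector_derivative_at scaleR_one cl_complex_of_real_mult cl_cis_eq_cl_complex)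
qed

text \<open>With real values a and b of the components at \<open>z\<close>, parity in y gives a + Jb
  at \<open>z\<close> and a - Jb at its conjugate.\<close>

lemma intrinsic_on_conjugate_pair:
  assumes "f \<in> intrinsic U" "J \<in> imag_sphere"
    and "(Re z, Im z) \<in> slice_domain U" "(Re z, - Im z) \<in> slice_domain U"
  obtains w where "f (cl_complex J z) = cl_complex J w" "f (cl_complex J (cnj z)) = cl_complex J (cnj w)"
proof -
  obtain f0 f1 where f: "slice_components U f f0 f1"
    and "\<forall>p\<in>slice_domain U. f0 p \<in> range cl_real \<and> f1 p \<in> range cl_real"
    using assms(1) by (auto simp: intrinsic_def)
  then obtain a b where ab: "f0 (Re z, Im z) = cl_real a" "f1 (Re z, Im z) = cl_real b"
    using assms(3) by blast
  have val: "f (cl_real x + y *\<^sub>R J) = f0 (x, y) + J \<odot> f1 (x, y)"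
    if "(x, y) \<in> slice_domain U" for x y
    using f that assms(2) unfolding slice_components_def by blast
  have sym: "f0 (Re z, - Im z) = f0 (Re z, Im z)" "f1 (Re z, - Im z) = - f1 (Re z, Im z)"
    using f assms(3) unfolding slice_components_def by blast+
  show thesis
    by (rule that[of "Complex a b"])
      (use val[OF assms(3)] val[OF assms(4)] sym ab in
        \<open>simp_all add: cl_complex_def lmul_cl_real linear_neg[OF linear_cl_lmul_right]\<close>)
qed

section \<open>Commuting operators\<close>

lemma total_obtain:
  assumes "dom X = UNIV"
  obtains x where "X v = Some x"
proof -
  have "v \<in> dom X" using assms by simp
  then show thesis using that by (auto simp: dom_def)
qed

lemma right_linear_linear:
  assumes "right_linear X" "dom X = UNIV"
  shows "linear (\<lambda>v. the (X v))"
proof (rule linearI)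
  have ex: "\<exists>x. X v = Some x" for v using total_obtain[OF assms(2)] by metis
  show "the (X (v + w)) = the (X v) + the (X w)" for v w
    using assms(1) ex[of v] ex[of w] unfolding right_linear_def by fastforce
  show "the (X (r *\<^sub>R v)) = r *\<^sub>R the (X v)" for r v
    using assms(1) ex[of v] unfolding right_linear_def by (metis cl_rmul_real option.sel)
qed

lemma right_linear_comp:
  assumes X: "right_linear X" and Y: "right_linear Y"
  shows "right_linear (X \<circ>\<^sub>m Y)"
  using assms unfolding right_linear_def map_comp_Some_iff by blast

lemma subspace_graph:
  assumes "right_linear X"
  shows "subspace {(v, w). X v = Some w}"
proof (rule subspaceI)
  show "0 \<in> {(v, w). X v = Some w}" using assms by (simp add: right_linear_def zero_prod_def)
  show "p + q \<in> {(v, w). X v = Some w}" if "p \<in> {(v, w). X v = Some w}" "q \<in> {(v, w). X v = Some w}" for p q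
    using that assms unfolding right_linear_def by (auto simp: plus_prod_def)
  show "r *\<^sub>R p \<in> {(v, w). X v = Some w}" if "p \<in> {(v, w). X v = Some w}" for r p
    using that assms unfolding right_linear_def by (auto simp: scaleR_prod_def) (metis cl_rmul_real)
qed

text \<open>For everywhere defined \<open>B\<close> this is the inclusion of BA in AB: applying
  \<open>B\<close> to both coordinates maps the graph of \<open>A\<close> into itself. Taking
  \<open>B\<close> from the Banach space of bounded operators makes sums, multiples and integrals of
  such \<open>B\<close> available.\<close>

definition commutes ::
  "('v::banach, 'n::{finite,linorder}) cl_op \<Rightarrow> ('v, 'n) cl_module \<Rightarrow>\<^sub>L ('v, 'n) cl_module \<Rightarrow> bool" where
  "commutes A B \<longleftrightarrow> (\<forall>v w. A v = Some w \<longrightarrow> A (B v) = Some (B w))"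

lemma commutesI:
  fixes B :: "('v::banach, 'n::{finite,linorder}) cl_module \<Rightarrow>\<^sub>L ('v, 'n) cl_module"
  shows "(\<And>v w. A v = Some w \<Longrightarrow> A (B v) = Some (B w)) \<Longrightarrow> commutes A B"
  by (simp add: commutes_def)

lemma commutes_add:
  assumes "right_linear A" "commutes A B" "commutes A C"
  shows "commutes A (B + C)"
  using subspace_add[OF subspace_graph[OF assms(1)]] assms(2,3)
  by (auto simp: commutes_def blinfun.add_left)

lemma commutes_scaleR:
  assumes "right_linear A" "commutes A B"
  shows "commutes A (r *\<^sub>R B)"
proof (rule commutesI)
  fix v w assume "A v = Some w"
  then have "(B v, B w) \<in> {(v, w). A v = Some w}" using assms(2) by (simp add: commutes_def)
  from subspace_scale[OF subspace_graph[OF assms(1)] this, of r]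
  show "A ((r *\<^sub>R B) v) = Some ((r *\<^sub>R B) w)" by (simp add: blinfun.scaleR_left)
qed

lemma commutes_zero: "right_linear A \<Longrightarrow> commutes A 0"
  by (simp add: commutes_def right_linear_def)

lemma commutes_id: "commutes A id_blinfun"
  by (simp add: commutes_def)

text \<open>For a fixed point (v, w) of the graph, evaluation of an operator at both v and w is
  bounded linear. It turns the operator valued integral into an integral of points of the graph, a
  closed subspace.\<close>

lemma commutes_has_integral:
  fixes F :: "real \<Rightarrow> ('v::banach, 'n::{finite,linorder}) cl_module \<Rightarrow>\<^sub>L ('v, 'n) cl_module"
  assumes "A \<in> closed_ops" "\<And>t. commutes A (F t)" "(F has_integral I) UNIV"
  shows "commutes A I"
proof (rule commutesI)
  fix v w assume vw: "A v = Some w"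
  let ?h = "\<lambda>B :: ('v, 'n) cl_module \<Rightarrow>\<^sub>L ('v, 'n) cl_module. (B v, B w)"
  have int: "((?h \<circ> F) has_integral ?h I) UNIV"
    by (rule has_integral_linear[OF assms(3)])
      (intro bounded_linear_Pair blinfun.bounded_linear_left)
  have G: "closed {(v, w). A v = Some w}" "subspace {(v, w). A v = Some w}"
    using assms(1) by (auto simp: closed_ops_def subspace_graph)
  have "(?h \<circ> F) t \<in> {(v, w). A v = Some w}" for t
    using assms(2)[of t] vw by (simp add: commutes_def)
  from closed_subspace_has_integral[OF G this int] have "?h I \<in> {(v, w). A v = Some w}" .
  then show "A (I v) = Some (I w)" by simp
qed

text \<open>
  Integrability of \<open>F\<close> need not be known: the integral of a function that is not integrable is \<open>0\<close>,
  which commutes with every right linear operator.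
\<close>

lemma commutes_integral:
  fixes F :: "real \<Rightarrow> ('v::banach, 'n::{finite,linorder}) cl_module \<Rightarrow>\<^sub>L ('v, 'n) cl_module"
  assumes A: "A \<in> closed_ops" and comm: "\<And>t. t \<noteq> 0 \<Longrightarrow> commutes A (F t + F (- t))"
  shows "commutes A (integral UNIV F)"
proof (cases "F integrable_on UNIV")
  case False
  then show ?thesis
    using A by (simp add: not_integrable_integral commutes_zero closed_ops_def)
next
  case True
  then have F: "(F has_integral integral UNIV F) UNIV" by (rule integrable_integral)
  \<comment> \<open>The symmetrised integrand has twice the integral of \<open>F\<close>; the factor
    is removed at the end.\<close>
  have "((\<lambda>t. F t + F (- t)) has_integral (integral UNIV F + integral UNIV F)) UNIV"
    by (rule has_integral_add[OF F has_integral_reflect_UNIV[OF F]])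
  \<comment> \<open>Nothing is assumed about \<open>F 0\<close>, so the value at this single point
    is replaced by 0.\<close>
  then have "((\<lambda>t. if t = 0 then 0 else F t + F (- t)) has_integral
      (integral UNIV F + integral UNIV F)) UNIV"
    by (rule has_integral_spike[where S = "{0}", rotated 2]) auto
  moreover have rlA: "right_linear A" using A by (simp add: closed_ops_def)
  have "commutes A (if t = 0 then 0 else F t + F (- t))" for t
    using comm[of t] commutes_zero[OF rlA] by (cases "t = 0") simp_all
  ultimately have "commutes A (integral UNIV F + integral UNIV F)"
    by (rule commutes_has_integral[OF A, rotated])
  then have "commutes A ((1 / 2) *\<^sub>R (integral UNIV F + integral UNIV F))"
    by (rule commutes_scaleR[OF rlA])
  then show ?thesis by (simp only: scaleR_2[symmetric] scaleR_scaleR) simp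
qed

section \<open>Inverse operators and the S-resolvent set\<close>

lemma op_inverse_SomeD:
  assumes inj: "inj_on X (dom X)" and w: "op_inverse X w = Some v"
  shows "X v = Some w"
proof -
  have ex: "\<exists>u. X u = Some w" using w unfolding op_inverse_def by (metis option.distinct(1))
  then obtain u where u: "X u = Some w" by blast
  have "u' = u" if "X u' = Some w" for u'
    using that u by (intro inj_onD[OF inj]) auto
  with u have "(THE u. X u = Some w) = u" by (rule the_equality)
  with w ex have "v = u" unfolding op_inverse_def by simp
  with u show ?thesis by simp
qed

lemma Q_inv_right_linear_total:
  assumes "s \<in> S_resolvent_set T"
  shows "right_linear (Q_inv s T)" "dom (Q_inv s T) = UNIV"
  using assms by (simp_all add: S_resolvent_set_def bounded_ops_def)

text \<open>The inverse of \<open>Q_op s T\<close> takes its values in the domain of T^2, hence in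
  that of \<open>T\<close>.\<close>

lemma dom_T_Q_inv:
  assumes "s \<in> S_resolvent_set T"
  shows "dom (T \<circ>\<^sub>m Q_inv s T) = UNIV"
proof -
  have "\<exists>y. (T \<circ>\<^sub>m Q_inv s T) v = Some y" for v
  proof -
    obtain x where x: "Q_inv s T v = Some x"
      by (rule total_obtain[OF Q_inv_right_linear_total(2)[OF assms]])
    have "Q_op s T x = Some v"
      by (rule op_inverse_SomeD[OF _ x]) (use assms in \<open>simp add: S_resolvent_set_def\<close>)
    then obtain z where "(T \<circ>\<^sub>m T) x = Some z" by (auto simp: Q_op_def map_option_eq_Some)
    then obtain y where "T x = Some y" by (auto simp: map_comp_Some_iff)
    with x show ?thesis by simp
  qed
  then show ?thesis unfolding dom_def by simp
qed

lemma to_blinfun_apply: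
  assumes "bounded_linear (\<lambda>v. the (X v))"
  shows "blinfun_apply (to_blinfun X) v = the (X v)"
  by (simp add: to_blinfun_def bounded_linear_Blinfun_apply[OF assms])

lemma bounded_ops_blinfun_apply:
  assumes "X \<in> bounded_ops"
  shows "blinfun_apply (to_blinfun X) v = the (X v)"
proof (rule to_blinfun_apply)
  have X: "right_linear X" "dom X = UNIV" "\<exists>K. \<forall>v. norm (the (X v)) \<le> K * norm v"
    using assms by (simp_all add: bounded_ops_def)
  then obtain K where "\<And>v. norm (the (X v)) \<le> K * norm v" by metis
  then show "bounded_linear (\<lambda>v. the (X v))"
    by (intro bounded_linear.intro bounded_linear_axioms.intro right_linear_linear X exI[of _ K])
      (simp add: mult.commute)
qed

section \<open>The integrand of the functional calculus\<close>

lemma S_L_inv_apply: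
  assumes "s \<in> S_resolvent_set T"
  shows "S_L_inv s T v = Some (the (Q_inv s T (cl_conj s \<odot> v)) - the ((T \<circ>\<^sub>m Q_inv s T) v))"
proof -
  obtain x where "Q_inv s T (cl_conj s \<odot> v) = Some x"
    by (rule total_obtain[OF Q_inv_right_linear_total(2)[OF assms]])
  moreover obtain y where "(T \<circ>\<^sub>m Q_inv s T) v = Some y"
    by (rule total_obtain[OF dom_T_Q_inv[OF assms]])
  ultimately show ?thesis by (simp add: S_L_inv_def op_minus_def lmul_op_def)
qed

text \<open>\<open>to_blinfun\<close> can be evaluated only after its argument is known to be
  bounded and linear. Linearity comes from the formula for \<open>S_L_inv\<close>, boundedness from
  the estimate \<open>bound\<close>.\<close>

lemma S_L_inv_lmul_apply:
  assumes T: "right_linear T" and s: "s \<in> S_resolvent_set T"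
    and bound: "\<And>v. norm (the (S_L_inv s T v)) \<le> K * norm v"
  shows "blinfun_apply (to_blinfun (S_L_inv s T \<circ>\<^sub>m lmul_op a)) v
    = the (Q_inv s T (cl_conj s \<odot> (a \<odot> v))) - the ((T \<circ>\<^sub>m Q_inv s T) (a \<odot> v))"
proof -
  note Q = Q_inv_right_linear_total[OF s]
  have "linear (\<lambda>v. the (S_L_inv s T v))"
    unfolding S_L_inv_apply[OF s] option.sel
    using right_linear_linear[OF right_linear_comp[OF T Q(1)] dom_T_Q_inv[OF s]]
      linear_compose[OF linear_cl_lmul_right right_linear_linear[OF Q]]
    by (intro linear_compose_sub) (simp_all add: o_def)
  then have "bounded_linear (\<lambda>v. the (S_L_inv s T v))"
    using bound
    by (intro bounded_linear.intro bounded_linear_axioms.intro exI[of _ K]) (simp_all add: mult.commute)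
  then have "bounded_linear (\<lambda>v. the (S_L_inv s T (a \<odot> v)))"
    by (rule bounded_linear_compose[OF _ bounded_linear_cl_lmul])
  moreover have "(S_L_inv s T \<circ>\<^sub>m lmul_op a) v = S_L_inv s T (a \<odot> v)" for v
    by (simp add: lmul_op_def)
  ultimately show ?thesis
    by (simp add: to_blinfun_apply S_L_inv_apply[OF s])
qed

lemma Q_op_cnj:
  "J \<in> imag_sphere \<Longrightarrow> Q_op (cl_complex J (cnj z)) T = Q_op (cl_complex J z) T"
  by (simp add: Q_op_def norm_cl_complex cl_complex_nth_empty)

lemma S_L_inv_conjugate_pair:
  assumes T: "right_linear T" and J: "J \<in> imag_sphere"
    and s: "cl_complex J z \<in> S_resolvent_set T" "cl_complex J (cnj z) \<in> S_resolvent_set T"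
    and bound: "\<And>v. norm (the (S_L_inv (cl_complex J z) T v)) \<le> K * norm v"
      "\<And>v. norm (the (S_L_inv (cl_complex J (cnj z)) T v)) \<le> K' * norm v"
  shows "blinfun_apply (to_blinfun (S_L_inv (cl_complex J z) T \<circ>\<^sub>m lmul_op (cl_complex J \<alpha>))
      + to_blinfun (S_L_inv (cl_complex J (cnj z)) T \<circ>\<^sub>m lmul_op (cl_complex J (cnj \<alpha>)))) v
    = (2 * Re (cnj z * \<alpha>)) *\<^sub>R the (Q_inv (cl_complex J z) T v)
      - (2 * Re \<alpha>) *\<^sub>R the ((T \<circ>\<^sub>m Q_inv (cl_complex J z) T) v)"
proof -
  define q where "q v = the (Q_inv (cl_complex J z) T v)" for v
  define p where "p v = the ((T \<circ>\<^sub>m Q_inv (cl_complex J z) T) v)" for v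
  note Q = Q_inv_right_linear_total[OF s(1)]
  have lin: "linear q" "linear p"
    unfolding q_def p_def
    by (intro right_linear_linear right_linear_comp dom_T_Q_inv T Q s)+
  have "blinfun_apply (to_blinfun (S_L_inv (cl_complex J z) T \<circ>\<^sub>m lmul_op (cl_complex J \<alpha>))
      + to_blinfun (S_L_inv (cl_complex J (cnj z)) T \<circ>\<^sub>m lmul_op (cl_complex J (cnj \<alpha>)))) v
    = q (cl_complex J (cnj z) \<odot> (cl_complex J \<alpha> \<odot> v)) - p (cl_complex J \<alpha> \<odot> v)
      + (q (cl_complex J z \<odot> (cl_complex J (cnj \<alpha>) \<odot> v)) - p (cl_complex J (cnj \<alpha>) \<odot> v))"
    by (simp only: blinfun.add_left S_L_inv_lmul_apply[OF T s(1) bound(1)]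
        S_L_inv_lmul_apply[OF T s(2) bound(2)] Q_op_cnj[OF J] cl_conj_cl_complex[OF J]
        complex_cnj_cnj q_def p_def)
  \<comment> \<open>\<open>cl_conj\<close> contributes the factor \<open>cnj z\<close> at
    \<open>z\<close> and the factor \<open>z\<close> at \<open>cnj z\<close>, so the arguments of
    \<open>q\<close> and of \<open>p\<close> are each multiplied by a conjugate pair.\<close>
  also have "\<dots> = q (cl_complex J (cnj z * \<alpha>) \<odot> v + cl_complex J (cnj (cnj z * \<alpha>)) \<odot> v)
      - p (cl_complex J \<alpha> \<odot> v + cl_complex J (cnj \<alpha>) \<odot> v)"
    by (simp add: linear_add[OF lin(1)] linear_add[OF lin(2)] cl_complex_mult[OF J]
        flip: cl_lmul_assoc)
  also have "\<dots> = (2 * Re (cnj z * \<alpha>)) *\<^sub>R q v - (2 * Re \<alpha>) *\<^sub>R p v"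
    by (simp only: cl_complex_add_cnj_lmul linear_scale[OF lin(1)] linear_scale[OF lin(2)])
  finally show ?thesis by (simp only: q_def p_def)
qed

lemma commutes_omega_calc:
  fixes T A :: "('v::banach, 'n::{finite,linorder}) cl_op" and f :: "'n clifford \<Rightarrow> 'n clifford"
  assumes \<omega>: "0 < \<omega>" "\<omega> < pi / 2" and T: "bisectorial \<omega> T" and A: "A \<in> closed_ops"
    and Q: "\<And>s. s \<in> paravectors - closure (double_sector \<omega>) \<Longrightarrow>
           Q_inv s T \<circ>\<^sub>m A \<subseteq>\<^sub>m A \<circ>\<^sub>m Q_inv s T"
    and TQ: "\<And>s. s \<in> paravectors - closure (double_sector \<omega>) \<Longrightarrow>
           T \<circ>\<^sub>m Q_inv s T \<circ>\<^sub>m A \<subseteq>\<^sub>m A \<circ>\<^sub>m T \<circ>\<^sub>m Q_inv s T"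
    and \<phi>: "\<omega> < \<phi>" "\<phi> < \<theta>" "\<theta> < pi / 2"
    and f: "f \<in> intrinsic (double_sector \<theta>)" and J: "J \<in> imag_sphere"
  shows "commutes A (omega_calc J \<phi> f T)"
proof -
  have rlT: "right_linear T" and rlA: "right_linear A"
    using T A by (auto simp: bisectorial_def closed_ops_def)
  have \<phi>': "0 < \<phi>" "\<phi> < pi / 2" using \<omega> \<phi> by auto
  obtain C where C: "\<And>s v. s \<in> paravectors - (double_sector \<phi> \<union> {0}) \<Longrightarrow>
      norm (the (S_L_inv s T v)) \<le> C / norm s * norm v"
    using T \<phi>' \<phi>(1) unfolding bisectorial_def by (metis greaterThanLessThan_iff)
  define F where "F \<epsilon> t = to_blinfun (S_L_inv (sector_path J \<phi> \<epsilon> t) T \<circ>\<^sub>m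
      lmul_op ((vector_derivative (sector_path J \<phi> \<epsilon>) (at t) \<odot> cl_inv J) \<odot>
        f (sector_path J \<phi> \<epsilon> t)))" for \<epsilon> t
  have "commutes A (F \<epsilon> t + F \<epsilon> (- t))" if \<epsilon>: "\<epsilon> \<in> {1, -1}" and t: "t \<noteq> 0" for \<epsilon> t
  proof -
    define z where "z = sector_point \<phi> \<epsilon> t"
    have path: "sector_path J \<phi> \<epsilon> t = cl_complex J z"
      "sector_path J \<phi> \<epsilon> (- t) = cl_complex J (cnj z)"
      by (simp_all add: sector_path_eq z_def sector_point_minus)
    note notin = sector_path_notin[OF J \<epsilon> \<omega>(1) \<phi>(1) \<phi>'(2)]
    have z: "cl_complex J z \<in> paravectors - closure (double_sector \<omega>)"
        "cl_complex J z \<in> paravectors - (double_sector \<phi> \<union> {0})"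
      and cnj_z: "cl_complex J (cnj z) \<in> paravectors - closure (double_sector \<omega>)"
        "cl_complex J (cnj z) \<in> paravectors - (double_sector \<phi> \<union> {0})"
      using notin[of t] notin[of "- t"] t by (simp_all add: path)
    have res: "cl_complex J z \<in> S_resolvent_set T" "cl_complex J (cnj z) \<in> S_resolvent_set T"
      using T z(1) cnj_z(1) by (auto simp: bisectorial_def S_spectrum_def)
    have "(Re z, Im z) \<in> slice_domain (double_sector \<theta> :: 'n clifford set)"
      "(Re z, - Im z) \<in> slice_domain (double_sector \<theta> :: 'n clifford set)"
      using sector_point_in_slice_domain[OF \<epsilon> \<phi>'(1) \<phi>(2), of t]
        sector_point_in_slice_domain[OF \<epsilon> \<phi>'(1) \<phi>(2), of "- t"] t
      by (simp_all add: z_def sector_point_minus)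
    then obtain w where w: "f (cl_complex J z) = cl_complex J w"
      "f (cl_complex J (cnj z)) = cl_complex J (cnj w)"
      by (rule intrinsic_on_conjugate_pair[OF f J])
    define \<alpha> where "\<alpha> = of_real (\<epsilon> * sgn t) * cis (- (sgn t * \<phi>)) * (- \<i>) * w"
    \<comment> \<open>Conjugation turns the factor -\<i>, which stands for 1/J, into \<i>; the sign
      change of \<open>sgn\<close> from \<open>t\<close> to \<open>- t\<close> makes up for
      this.\<close>
    have cnj_\<alpha>: "of_real (\<epsilon> * sgn (- t)) * cis (- (sgn (- t) * \<phi>)) * (- \<i>) * cnj w = cnj \<alpha>"
      by (simp add: \<alpha>_def sgn_minus cis_cnj)
    have F: "F \<epsilon> t = to_blinfun (S_L_inv (cl_complex J z) T \<circ>\<^sub>m lmul_op (cl_complex J \<alpha>))"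
      "F \<epsilon> (- t) = to_blinfun (S_L_inv (cl_complex J (cnj z)) T \<circ>\<^sub>m lmul_op (cl_complex J (cnj \<alpha>)))"
      unfolding F_def path cl_inv_imag_unit[OF J] w vector_derivative_sector_path[OF t]
        vector_derivative_sector_path[of "- t", unfolded neg_equal_0_iff_equal, OF t]
        cl_complex_mult[OF J] cnj_\<alpha> \<alpha>_def[symmetric] by (rule refl)+
    have F_apply: "(F \<epsilon> t + F \<epsilon> (- t)) v
        = (2 * Re (cnj z * \<alpha>)) *\<^sub>R the (Q_inv (cl_complex J z) T v)
          - (2 * Re \<alpha>) *\<^sub>R the ((T \<circ>\<^sub>m Q_inv (cl_complex J z) T) v)" for v
      unfolding F by (rule S_L_inv_conjugate_pair[OF rlT J res C[OF z(2)] C[OF cnj_z(2)]])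
    show ?thesis
    proof (rule commutesI)
      fix v w assume vw: "A v = Some w"
      let ?G = "{(v, w). A v = Some w}"
      obtain x x' y y' where
        x: "Q_inv (cl_complex J z) T v = Some x" "Q_inv (cl_complex J z) T w = Some x'" and
        y: "(T \<circ>\<^sub>m Q_inv (cl_complex J z) T) v = Some y" "(T \<circ>\<^sub>m Q_inv (cl_complex J z) T) w = Some y'"
        using total_obtain[OF Q_inv_right_linear_total(2)[OF res(1)]]
          total_obtain[OF dom_T_Q_inv[OF res(1)]] by metis
      have "(Q_inv (cl_complex J z) T \<circ>\<^sub>m A) v = Some x'" using vw x by simp
      then have "(A \<circ>\<^sub>m Q_inv (cl_complex J z) T) v = Some x'"
        using Q[OF z(1)] by (metis map_le_def domI)
      then have "(x, x') \<in> ?G" using x by simp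
      moreover
      have "(T \<circ>\<^sub>m Q_inv (cl_complex J z) T \<circ>\<^sub>m A) v = Some y'"
        using vw y(2) by (simp add: map_comp_def)
      then have "(A \<circ>\<^sub>m T \<circ>\<^sub>m Q_inv (cl_complex J z) T) v = Some y'"
        using TQ[OF z(1)] by (metis map_le_def domI)
      \<comment> \<open>Composition associates to the left, so the value is reached through
        \<open>x\<close>: with x(1), the fact y(1) says that \<open>T\<close> maps \<open>x\<close>
        to \<open>y\<close>.\<close>
      then have "(y, y') \<in> ?G" using y(1) x(1) by simp
      ultimately have "(2 * Re (cnj z * \<alpha>)) *\<^sub>R (x, x') - (2 * Re \<alpha>) *\<^sub>R (y, y') \<in> ?G"
        by (intro subspace_diff subspace_scale subspace_graph rlA)
      then show "A ((F \<epsilon> t + F \<epsilon> (- t)) v) = Some ((F \<epsilon> t + F \<epsilon> (- t)) w)"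
        unfolding F_apply x y option.sel by simp
    qed
  qed
  then have "commutes A (integral UNIV (F \<epsilon>))" if "\<epsilon> \<in> {1, -1}" for \<epsilon>
    using that by (intro commutes_integral[OF A]) blast
  then show ?thesis
    unfolding omega_calc_def F_def[symmetric]
    by (intro commutes_scaleR[OF rlA]) (simp add: commutes_add[OF rlA])
qed

section \<open>The extended calculus\<close>

theorem theorem4p11:
  fixes T A :: "('v::banach, 'n::{finite,linorder}) cl_op"
    and g :: "'n clifford \<Rightarrow> 'n clifford" and J :: "'n clifford"
    and \<omega> \<theta> \<phi> :: real
  assumes "\<omega> \<in> {0 <..< pi / 2}"
    and "bisectorial \<omega> T"
    and "A \<in> closed_ops"
    and "\<And>s. s \<in> paravectors - closure (double_sector \<omega>) \<Longrightarrow>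
           Q_inv s T \<circ>\<^sub>m A \<subseteq>\<^sub>m A \<circ>\<^sub>m Q_inv s T"
    and "\<And>s. s \<in> paravectors - closure (double_sector \<omega>) \<Longrightarrow>
           T \<circ>\<^sub>m Q_inv s T \<circ>\<^sub>m A \<subseteq>\<^sub>m A \<circ>\<^sub>m T \<circ>\<^sub>m Q_inv s T"
    and "\<theta> \<in> {\<omega> <..< pi / 2}"
    and "g \<in> intrinsic_bnd \<theta>"
    and "\<phi> \<in> {\<omega> <..< \<theta>}"
    and "J \<in> imag_sphere"
  shows "ext_omega_calc \<theta> J \<phi> g T \<circ>\<^sub>m A \<subseteq>\<^sub>m A \<circ>\<^sub>m ext_omega_calc \<theta> J \<phi> g T"
proof -
  obtain g0 ginf gt where c: "(SOME c. bnd_components \<theta> g c) = (g0, ginf, gt)"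
    using prod_cases3 by blast
  \<comment> \<open>Whichever components the choice returns, they satisfy the defining property, so
    \<open>gt\<close> is intrinsic.\<close>
  have "bnd_components \<theta> g (SOME c. bnd_components \<theta> g c)"
    using assms(7) unfolding intrinsic_bnd_def by (auto intro: someI_ex)
  then have gt: "gt \<in> intrinsic (double_sector \<theta>)"
    unfolding c by (simp add: bnd_components_def intrinsic0_def)
  have rlA: "right_linear A" using assms(3) by (simp add: closed_ops_def)
  \<comment> \<open>Since \<open>J\<close> has norm 1 and real part 0, membership in the closure
    would force cos \<omega> to be at most 0.\<close>
  have "0 < cos \<omega>" using assms(1) by (intro cos_gt_zero) auto
  then have "J \<notin> closure (double_sector \<omega>)"
    using closure_double_sector_bound[of \<omega> J] assms(1,9) by (auto simp: imag_sphere_def)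
  then have J: "J \<in> paravectors - closure (double_sector \<omega>)"
    using assms(9) by (simp add: imag_sphere_def)
  then have res: "J \<in> S_resolvent_set T"
    using assms(2) by (auto simp: bisectorial_def S_spectrum_def)
  then have "Q_inv J T \<in> bounded_ops" by (simp add: S_resolvent_set_def)
  \<comment> \<open>This is the term with (1 + T^2)^{-1}: by \<open>one_plus_sq_eq_Q_op\<close>, 1 +
    T^2 is \<open>Q_op J T\<close>.\<close>
  have "commutes A (to_blinfun (Q_inv J T))"
  proof (rule commutesI)
    fix v w assume vw: "A v = Some w"
    obtain x x' where x: "Q_inv J T v = Some x" "Q_inv J T w = Some x'"
      using total_obtain[OF Q_inv_right_linear_total(2)[OF res]] by metis
    have "(Q_inv J T \<circ>\<^sub>m A) v = Some x'" using vw x by simp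
    then have "(A \<circ>\<^sub>m Q_inv J T) v = Some x'" using assms(4)[OF J] by (metis map_le_def domI)
    then show "A (to_blinfun (Q_inv J T) v) = Some (to_blinfun (Q_inv J T) w)"
      using x by (simp add: bounded_ops_blinfun_apply[OF \<open>Q_inv J T \<in> bounded_ops\<close>])
  qed
  moreover have "commutes A (omega_calc J \<phi> gt T)"
    by (rule commutes_omega_calc[of \<omega>]) (use assms gt in auto)
  ultimately have "commutes A (ginf *\<^sub>R id_blinfun
      + (g0 - ginf) *\<^sub>R to_blinfun (op_inverse (one_plus_sq T)) + omega_calc J \<phi> gt T)"
    unfolding one_plus_sq_eq_Q_op[OF assms(9)]
    by (intro commutes_add commutes_scaleR commutes_id rlA)
  then show ?thesis
    unfolding ext_omega_calc_def c of_blinfun_def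
    by (auto simp: map_le_def commutes_def dom_def map_comp_Some_iff)
qed

end
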